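(* For $1\leq n\leq 4$, $a_n(231;321)=1$, and for $n\geq 5$, $a_n(231;321)=0$.
   Context: $\mathcal{S}_n$ is the set of permutations of $[n]=\{1,\dots,n\}$, written in one-line notation $\pi=\pi_1\pi_2\cdots\pi_n$ with $\pi_i=\pi(i)$. A permutation is cyclic if it consists of exactly one $n$-cycle. For a cyclic $\pi$, its standard cycle notation is $C(\pi)=(c_1,c_2,\dots,c_n)$ with $c_1=1$ and $c_i=\pi_{c_{i-1}}$ for $2\le i\le n$. A sequence of distinct integers $w_1\cdots w_m$ contains a pattern $\sigma\in\mathcal{S}_k$ if there are indices $i_1<\dots<i_k$ with $w_{i_1}\cdots w_{i_k}$ in the same relative order as $\sigma_1\cdots\sigma_k$; otherwise it avoids $\sigma$. For $\sigma,\tau\in\mathcal{S}_3$, $\mathcal{A}_n(\sigma;\tau)$ is the set of cyclic permutations $\pi\in\mathcal{S}_n$ whose one-line notation avoids $\sigma$ and whose cycle notation $C(\pi)$ (as the sequence $c_1c_2\cdots c_n$) avoids $\tau$; $a_n(\sigma;\tau)=|\mathcal{A}_n(\sigma;\tau)|$. *)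

theory Defs
  imports "HOL-Combinatorics.Combinatorics"
begin

definition one_line :: "nat \<Rightarrow> (nat \<Rightarrow> nat) \<Rightarrow> nat list" where
  "one_line n \<pi> = map \<pi> [1..<n + 1]"

text \<open>
  The standard cycle notation \<open>c\<^sub>1 c\<^sub>2 \<dots> c\<^sub>n\<close> with \<open>c\<^sub>1 = 1\<close> and \<open>c\<^sub>i = \<pi> c\<^sub>i\<^sub>-\<^sub>1\<close>, as a list; its entry
  at the 0-based position \<open>i\<close> is the \<open>i\<close>-th iterate of \<open>\<pi>\<close> at 1.
\<close>
definition cycle_word :: "nat \<Rightarrow> (nat \<Rightarrow> nat) \<Rightarrow> nat list" where
  "cycle_word n \<pi> = map (\<lambda>i. (\<pi> ^^ i) 1) [0..<n]"

text \<open>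
  A pattern is given by its one-line notation, e.g. \<open>[2, 3, 1]\<close> for 231. The function \<open>f\<close> enumerates
  the positions \<open>i\<^sub>1 < \<dots> < i\<^sub>k\<close> of an occurrence, all counted from 0.
\<close>
definition contains_pattern :: "nat list \<Rightarrow> nat list \<Rightarrow> bool" where
  "contains_pattern w \<sigma> \<longleftrightarrow>
     (\<exists>f :: nat \<Rightarrow> nat.
        strict_mono_on {..<length \<sigma>} f \<and>
        (\<forall>a<length \<sigma>. f a < length w) \<and>
        (\<forall>a<length \<sigma>. \<forall>b<length \<sigma>. w ! f a < w ! f b \<longleftrightarrow> \<sigma> ! a < \<sigma> ! b))"

abbreviation avoids :: "nat list \<Rightarrow> nat list \<Rightarrow> bool" where
  "avoids w \<sigma> \<equiv> \<not> contains_pattern w \<sigma>"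

definition cyclic_avoiders :: "nat \<Rightarrow> nat list \<Rightarrow> nat list \<Rightarrow> (nat \<Rightarrow> nat) set" where
  "cyclic_avoiders n \<sigma> \<tau> =
     {\<pi>. \<pi> permutes {1..n} \<and> cyclic_on \<pi> {1..n} \<and>
         avoids (one_line n \<pi>) \<sigma> \<and> avoids (cycle_word n \<pi>) \<tau>}"

definition num_cyclic_avoiders :: "nat \<Rightarrow> nat list \<Rightarrow> nat list \<Rightarrow> nat" where
  "num_cyclic_avoiders n \<sigma> \<tau> = card (cyclic_avoiders n \<sigma> \<tau>)"

lemma finite_cyclic_avoiders: "finite (cyclic_avoiders n \<sigma> \<tau>)"
  by (rule finite_subset[OF _ finite_permutations[of "{1..n}"]])
    (auto simp: cyclic_avoiders_def)

end

theory Submission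
  imports Defs
begin

text \<open>
  Let \<open>j\<close> be the last entry of the cycle word, so that \<open>\<pi> j = 1\<close>. Avoiding 231 in one-line notation
  makes \<open>\<pi>\<close> decreasing on \<open>{1..j}\<close>, and avoiding 321 in the cycle word, which ends with \<open>j\<close>,
  makes the entries exceeding \<open>j\<close> increase along the cycle word. Together these force
  \<open>\<pi> 1 = j + 1\<close>. Then \<open>\<pi>\<close> maps \<open>{2..<j}\<close> into \<open>{2..j}\<close>; as \<open>\<pi>\<close> is cyclic, this set is either
  empty or not invariant, and in the second case \<open>\<pi> 2 = j\<close>, so the cycle word ends with \<open>2, j\<close> and
  avoidance of 321 forces \<open>j = 3\<close>. So \<open>j\<close> is 2 or 3, and for \<open>n \<ge> 5\<close> the values of \<open>\<pi>\<close> at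
  \<open>1\<close>, \<open>j + 1\<close> and \<open>\<pi>\<inverse> 2\<close> form the pattern 231.
\<close>

section \<open>Patterns of length three as inequalities between entries\<close>

lemma contains_pattern_length_3:
  "contains_pattern w [x, y, z] \<longleftrightarrow>
     (\<exists>i j k. i < j \<and> j < k \<and> k < length w \<and>
        (w ! i < w ! j \<longleftrightarrow> x < y) \<and> (w ! j < w ! i \<longleftrightarrow> y < x) \<and>
        (w ! i < w ! k \<longleftrightarrow> x < z) \<and> (w ! k < w ! i \<longleftrightarrow> z < x) \<and>
        (w ! j < w ! k \<longleftrightarrow> y < z) \<and> (w ! k < w ! j \<longleftrightarrow> z < y))"
  (is "_ \<longleftrightarrow> (\<exists>i j k. ?P i j k)")
proof
  assume "contains_pattern w [x, y, z]"
  then obtain f :: "nat \<Rightarrow> nat"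
    where "strict_mono_on {..<length [x, y, z]} f"
      and "\<forall>a<length [x, y, z]. f a < length w"
      and "\<forall>a<length [x, y, z]. \<forall>b<length [x, y, z].
             w ! f a < w ! f b \<longleftrightarrow> [x, y, z] ! a < [x, y, z] ! b"
    unfolding contains_pattern_def by blast
  then have "?P (f 0) (f 1) (f 2)"
    by (auto simp: strict_mono_on_def eval_nat_numeral All_less_Suc)
  then show "\<exists>i j k. ?P i j k" by blast
next
  assume "\<exists>i j k. ?P i j k"
  then obtain i j k where P: "?P i j k" by blast
  show "contains_pattern w [x, y, z]"
    unfolding contains_pattern_def
    by (rule exI[of _ "\<lambda>a. [i, j, k] ! a"])
      (use P in \<open>auto simp: strict_mono_on_def less_Suc_eq All_less_Suc eval_nat_numeral\<close>)
qed

text \<open>Transitivity recovers all other comparisons from these two. The bounded quantifiers can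
  be unrolled by \<open>All_less_Suc\<close> on an explicit word.\<close>

lemma avoids_231_iff:
  "avoids w [2, 3, 1] \<longleftrightarrow>
     (\<forall>k<length w. \<forall>j<k. \<forall>i<j. \<not> (w ! k < w ! i \<and> w ! i < w ! j))"
  unfolding contains_pattern_length_3 by simp (meson less_trans less_asym)

lemma avoids_321_iff:
  "avoids w [3, 2, 1] \<longleftrightarrow>
     (\<forall>k<length w. \<forall>j<k. \<forall>i<j. \<not> (w ! k < w ! j \<and> w ! j < w ! i))"
  unfolding contains_pattern_length_3 by simp (meson less_trans less_asym)

section \<open>Cyclicity in terms of the cycle word\<close>

lemma set_cycle_word: "set (cycle_word n \<pi>) = (\<lambda>i. (\<pi> ^^ i) 1) ` {..<n}"
  by (auto simp: cycle_word_def)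

text \<open>The iterates before the first return to \<open>x\<close> are distinct and exhaust the
  orbit, which is \<open>S\<close>; so the return time is \<open>card S\<close>.\<close>

lemma cyclic_on_funpow_card:
  fixes f :: "'a \<Rightarrow> 'a"
  assumes "cyclic_on f S" "x \<in> S"
  shows "(\<lambda>i. (f ^^ i) x) ` {..<card S} = S" "(f ^^ card S) x = x"
proof -
  have orb: "orbit f x = S"
    using assms by (simp add: cyclic_on_alldef)
  then have x: "x \<in> orbit f x"
    using assms by simp
  have im: "S = (\<lambda>i. (f ^^ i) x) ` {0..<funpow_dist1 f x x}"
    using orbit_conv_funpow_dist1[OF x] orb by simp
  moreover have "inj_on (\<lambda>i. (f ^^ i) x) {0..<funpow_dist1 f x x}"
    using inj_on_funpow_dist1[OF x] .
  ultimately have card: "card S = funpow_dist1 f x x"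
    by (metis card_image card_atLeastLessThan diff_zero)
  show "(\<lambda>i. (f ^^ i) x) ` {..<card S} = S"
    using im unfolding card by (simp add: atLeast0LessThan)
  show "(f ^^ card S) x = x"
    using funpow_dist1_prop[OF x] card by simp
qed

text \<open>This turns cyclicity of an explicit permutation into a finite computation.\<close>

lemma cyclic_on_iff_cycle_word:
  assumes "\<pi> permutes {1..n}" "1 \<le> n"
  shows "cyclic_on \<pi> {1..n} \<longleftrightarrow> set (cycle_word n \<pi>) = {1..n}"
proof
  assume "cyclic_on \<pi> {1..n}"
  from cyclic_on_funpow_card(1)[OF this, of 1] show "set (cycle_word n \<pi>) = {1..n}"
    using assms by (simp add: set_cycle_word)
next
  assume eq: "set (cycle_word n \<pi>) = {1..n}"
  have self: "1 \<in> orbit \<pi> 1"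
    by (rule permutation_self_in_orbit[OF permutation_permutes[THEN iffD2]])
      (use assms(1) in blast)
  then have orbit: "orbit \<pi> 1 = range (\<lambda>i. (\<pi> ^^ i) 1)"
    by (rule orbit_altdef_self_in[THEN trans]) (simp add: full_SetCompr_eq)
  have "{1..n} \<subseteq> orbit \<pi> 1"
    unfolding orbit eq[symmetric] set_cycle_word by (rule image_mono) simp
  moreover have "orbit \<pi> 1 \<subseteq> {1..n}"
    by (rule permutes_orbit_subset[OF assms(1)]) (use assms(2) in simp)
  ultimately have "{1..n} = orbit \<pi> 1"
    by (rule subset_antisym)
  then show "cyclic_on \<pi> {1..n}"
    unfolding cyclic_on_def using self by (intro bexI[of _ 1]) simp_all
qed

section \<open>No such permutation for n >= 5\<close>

lemma cyclic_avoiders_231_321_ge_5: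
  assumes n: "n \<ge> 5"
  shows "cyclic_avoiders n [2, 3, 1] [3, 2, 1] = {}"
proof (rule equals0I)
  fix \<pi> assume "\<pi> \<in> cyclic_avoiders n [2, 3, 1] [3, 2, 1]"
  then have perm: "\<pi> permutes {1..n}" and cyc: "cyclic_on \<pi> {1..n}"
    and av1: "avoids (one_line n \<pi>) [2, 3, 1]" and av2: "avoids (cycle_word n \<pi>) [3, 2, 1]"
    by (auto simp: cyclic_avoiders_def)
  define c where "c i = (\<pi> ^^ i) 1" for i
  define j where "j = c (n - 1)"
  have c_Suc: "c (Suc i) = \<pi> (c i)" for i
    by (simp add: c_def)
  have c_0: "c 0 = 1"
    by (simp add: c_def)
  have c_im: "c ` {..<n} = {1..n}" and c_n: "c n = 1"
    using cyclic_on_funpow_card[OF cyc, of 1] n by (simp_all add: c_def)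
  have c_inj: "inj_on c {..<n}"
    by (rule eq_card_imp_inj_on) (simp_all add: c_im)
  have c_neq: "c i \<noteq> c k" if "i < n" "k < n" "i \<noteq> k" for i k
    using c_inj that by (auto dest: inj_onD)
  have c_in: "c i \<in> {1..n}" if "i < n" for i
    using that c_im by blast
  have c_surj: "\<exists>i<n. c i = x" if "1 \<le> x" "x \<le> n" for x
    using that c_im by (metis atLeastAtMost_iff imageE lessThan_iff)
  have pi_in: "1 \<le> \<pi> x \<and> \<pi> x \<le> n" if "1 \<le> x" "x \<le> n" for x
    using permutes_in_image[OF perm, of x] that by simp
  have pi_inj: "\<pi> x = \<pi> y \<longleftrightarrow> x = y" for x y
    using permutes_inj[OF perm] by (auto dest: injD)
  have pi_surj: "\<exists>a. 1 \<le> a \<and> a \<le> n \<and> \<pi> a = y" if "1 \<le> y" "y \<le> n" for y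
    using permutes_image[OF perm] that by (metis atLeastAtMost_iff imageE)
  have no_231: "\<not> (\<pi> z < \<pi> x \<and> \<pi> x < \<pi> y)" if "1 \<le> x" "x < y" "y < z" "z \<le> n" for x y z
  proof -
    have "z - 1 < length (one_line n \<pi>)" "y - 1 < z - 1" "x - 1 < y - 1"
      using that by (auto simp: one_line_def)
    then have "\<not> (one_line n \<pi> ! (z - 1) < one_line n \<pi> ! (x - 1) \<and>
        one_line n \<pi> ! (x - 1) < one_line n \<pi> ! (y - 1))"
      using av1 unfolding avoids_231_iff by blast
    then show ?thesis
      using that by (simp add: one_line_def del: upt_Suc)
  qed
  have no_321: "\<not> (c m < c k \<and> c k < c i)" if "i < k" "k < m" "m < n" for i k m
  proof -
    have "m < length (cycle_word n \<pi>)"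
      using that by (simp add: cycle_word_def)
    then have "\<not> (cycle_word n \<pi> ! m < cycle_word n \<pi> ! k \<and>
        cycle_word n \<pi> ! k < cycle_word n \<pi> ! i)"
      using av2 that unfolding avoids_321_iff by blast
    then show ?thesis
      using that by (simp add: cycle_word_def c_def)
  qed
  have pi_j: "\<pi> j = 1"
    using c_Suc[of "n - 1"] c_n n by (simp add: j_def)
  have j_le: "j \<le> n" and j_ge: "2 \<le> j"
    using c_in[of "n - 1"] c_neq[of "n - 1" 0] c_0 n by (auto simp: j_def)
  have c1: "c 1 = \<pi> 1"
    using c_Suc[of 0] c_0 by simp
  have pi1_neq_j: "\<pi> 1 \<noteq> j"
    using c_neq[of 1 "n - 1"] n c1 by (simp add: j_def)
  \<comment> \<open>If \<open>y \<noteq> j\<close> and \<open>\<pi> x < \<pi> y\<close>, then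
    \<open>x\<close>, \<open>y\<close>, \<open>j\<close> carry the pattern 231, since
    \<open>\<pi> j = 1\<close>.\<close>
  have decr: "\<pi> y < \<pi> x" if "1 \<le> x" "x < y" "y \<le> j" for x y
  proof -
    have "1 < \<pi> x"
      using pi_in[of x] pi_inj[of x j] pi_j that j_le by (cases "\<pi> x = 1") simp_all
    moreover have "\<pi> x \<noteq> \<pi> y"
      using pi_inj that by simp
    moreover have "\<not> (\<pi> j < \<pi> x \<and> \<pi> x < \<pi> y)" if "y \<noteq> j"
      using no_231[of x y j] \<open>1 \<le> x\<close> \<open>x < y\<close> \<open>y \<le> j\<close> that j_le by simp
    ultimately show ?thesis
      using pi_j by (cases "y = j") auto
  qed
  have decr_le: "\<pi> x \<le> \<pi> 1" if "1 \<le> x" "x \<le> j" for x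
    using decr[of 1 x] that by (cases "x = 1") auto
  \<comment> \<open>For \<open>j = n\<close> the decreasing \<open>\<pi>\<close> has its maximum at
    1, so \<open>\<pi> 1 = n = j\<close>; but these are entries 1 and \<open>n - 1\<close> of the
    cycle word.\<close>
  have "j \<noteq> n"
  proof
    assume "j = n"
    obtain a where "1 \<le> a" "a \<le> n" "\<pi> a = n"
      using pi_surj[of n] n by auto
    then have "\<pi> 1 = n"
      using decr_le[of a] pi_in[of 1] \<open>j = n\<close> by simp
    then show False
      using pi1_neq_j \<open>j = n\<close> by simp
  qed
  then have j_less: "j < n"
    using j_le by simp
  have "j \<le> \<pi> 1"
  proof -
    have "\<pi> ` {1..j} \<subseteq> {1..\<pi> 1}"
      using decr_le pi_in j_le by auto
    then have "card (\<pi> ` {1..j}) \<le> card {1..\<pi> 1}"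
      by (intro card_mono) auto
    then show ?thesis
      by (simp add: card_image permutes_inj_on[OF perm])
  qed
  then have pi1_gt: "j < \<pi> 1"
    using pi1_neq_j by simp
  \<comment> \<open>Otherwise \<open>j + 1\<close> occurs strictly between \<open>\<pi> 1\<close>
    and the final \<open>j\<close> in the cycle word, and \<open>\<pi> 1 > j + 1 > j\<close> is a
    321.\<close>
  have pi1: "\<pi> 1 = j + 1"
  proof (rule ccontr)
    assume neq: "\<pi> 1 \<noteq> j + 1"
    obtain k where k: "k < n" "c k = j + 1"
      using c_surj[of "j + 1"] j_less by auto
    have "c k \<noteq> c 0" "c k \<noteq> c 1" "c k \<noteq> c (n - 1)"
      using k c_0 c1 neq j_ge by (simp_all add: j_def)
    then have "k \<noteq> 0" "k \<noteq> 1" "k \<noteq> n - 1"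
      by metis+
    then have "1 < k" "k < n - 1"
      using k by linarith+
    then show False
      using no_321[of 1 k "n - 1"] k c1 neq pi1_gt n by (simp add: j_def)
  qed
  have "j \<le> 3"
  proof (rule ccontr)
    assume "\<not> j \<le> 3"
    have mid: "2 \<le> \<pi> x \<and> \<pi> x \<le> j" if "2 \<le> x" "x < j" for x
      using decr[of x j] decr[of 1 x] that pi_j pi1 by simp
    show False
    proof (cases "\<exists>a. 2 \<le> a \<and> a < j \<and> \<pi> a = j")
      case True
      then obtain a where a: "2 \<le> a" "a < j" "\<pi> a = j" by blast
      \<comment> \<open>The value \<open>j\<close> is the largest possible on
        \<open>{2..<j}\<close>, so the decreasing \<open>\<pi>\<close> takes it at the left end.
        Then 2 is the penultimate entry, and \<open>j + 1\<close>, 3, 2 is a 321 because 3 differs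
        from \<open>j\<close>.\<close>
      have "a = 2"
        using decr[of 2 a] mid[of 2] a by fastforce
      have "\<pi> (c (n - 2)) = j"
        using c_Suc[of "n - 2"] n Suc_diff_Suc[of 1 n] by (simp add: j_def numeral_2_eq_2)
      then have c2: "c (n - 2) = 2"
        using a \<open>a = 2\<close> pi_inj by metis
      obtain k where k: "k < n" "c k = 3"
        using c_surj[of 3] n by auto
      have "c k \<noteq> c 0" "c k \<noteq> c 1" "c k \<noteq> c (n - 1)" "c k \<noteq> c (n - 2)"
        using k c_0 c1 c2 pi1 \<open>\<not> j \<le> 3\<close> by (simp_all add: j_def)
      then have "k \<noteq> 0" "k \<noteq> 1" "k \<noteq> n - 1" "k \<noteq> n - 2"
        by metis+
      then have "1 < k" "k < n - 2"
        using k by linarith+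
      then show False
        using no_321[of 1 k "n - 2"] k c1 c2 pi1 n \<open>\<not> j \<le> 3\<close> by simp
    next
      case False
      obtain i where i: "i < n" "c i = 2"
        using c_surj[of 2] n by auto
      \<comment> \<open>Now \<open>{2..<j}\<close> is invariant, so from 2 the cycle can never
        return to \<open>c n = 1\<close>.\<close>
      have "2 \<le> c (i + t) \<and> c (i + t) < j" for t
      proof (induction t)
        case 0
        then show ?case using i \<open>\<not> j \<le> 3\<close> by simp
      next
        case (Suc t)
        then show ?case
          using mid[of "c (i + t)"] False c_Suc[of "i + t"] by fastforce
      qed
      from this[of "n - i"] show False
        using i c_n by simp
    qed
  qed
  have fix_2: "\<pi> 2 \<noteq> 2"
  proof
    assume eq: "\<pi> 2 = 2"
    obtain i where i: "i < n" "c i = 2"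
      using c_surj[of 2] n by auto
    then have "c (Suc i) = c i"
      using c_Suc eq by simp
    then show False
      using c_neq[of "Suc i" i] c_n i by (cases "Suc i = n") auto
  qed
  have j_cases: "j = 2 \<or> j = 3 \<and> \<pi> 2 = 3"
  proof (cases "j = 2")
    case False
    then have "j = 3"
      using j_ge \<open>j \<le> 3\<close> by simp
    then show ?thesis
      using decr[of 1 2] decr[of 2 3] pi1 pi_j fix_2 by simp
  qed simp
  have low: "\<pi> b \<noteq> 2" if "1 \<le> b" "b \<le> j" for b
  proof -
    have "b = 1 \<or> b = 2 \<or> b = j"
      using that j_cases by linarith
    then show ?thesis
      using fix_2 pi1 pi_j j_ge by (elim disjE) simp_all
  qed
  \<comment> \<open>This covers both cases at once: \<open>{3..j}\<close> is empty for
    \<open>j = 2\<close> and is \<open>{3}\<close> for \<open>j = 3\<close>, where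
    \<open>\<pi> 2 = 3\<close>.\<close>
  have mid: "\<pi> 2 = x" if "x \<in> {3..j}" for x
    using that j_cases by (elim disjE) auto
  \<comment> \<open>Otherwise the cycle word begins 1, \<open>j + 1\<close>, 2,
    \<open>\<pi> 2\<close>, so \<open>j\<close> appears at position 2 or 3. Its position is
    \<open>n - 1\<close>, which is at least 4 because \<open>n \<ge> 5\<close>.\<close>
  have not_2: "\<pi> (j + 1) \<noteq> 2"
  proof
    assume eq: "\<pi> (j + 1) = 2"
    have c2: "c 2 = 2"
      using c_Suc[of 1] c1 pi1 eq by (simp add: numeral_eq_Suc)
    then have c3: "c 3 = \<pi> 2"
      using c_Suc[of 2] by (simp add: numeral_eq_Suc)
    have "c 2 \<noteq> j" "c 3 \<noteq> j"
      using c_neq[of 2 "n - 1"] c_neq[of 3 "n - 1"] n by (auto simp: j_def)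
    then show False
      using mid[of j] c2 c3 j_ge by simp
  qed
  \<comment> \<open>No value up to \<open>j + 1\<close> is left for \<open>\<pi> (j + 1)\<close>: 1
    is \<open>\<pi> j\<close>, 2 was excluded, \<open>{3..j}\<close> is used up by
    \<open>\<pi> 2\<close>, and \<open>j + 1\<close> is \<open>\<pi> 1\<close>.\<close>
  have "\<pi> 1 < \<pi> (j + 1)"
  proof (rule ccontr)
    assume "\<not> \<pi> 1 < \<pi> (j + 1)"
    moreover have "\<pi> (j + 1) \<noteq> \<pi> 1" "\<pi> (j + 1) \<noteq> \<pi> j" "\<pi> (j + 1) \<noteq> \<pi> 2"
      using j_ge by (simp_all add: pi_inj)
    ultimately have "\<pi> (j + 1) \<in> {3..j}"
      using pi1 pi_j not_2 pi_in[of "j + 1"] j_less by auto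
    then show False
      using mid \<open>\<pi> (j + 1) \<noteq> \<pi> 2\<close> by metis
  qed
  moreover obtain b where b: "1 \<le> b" "b \<le> n" "\<pi> b = 2"
    using pi_surj[of 2] n by auto
  moreover have "j + 1 < b"
    using low[of b] not_2 b by (cases "b \<le> j"; cases "b = j + 1") simp_all
  ultimately show False
    using no_231[of 1 "j + 1" b] j_ge pi1 by simp
qed

section \<open>Exactly one such permutation for 1 <= n <= 4\<close>

lemma cyclic_avoiders_eqI:
  assumes n: "1 \<le> n" and cs: "set cs = {1..n}"
    and words: "cycle_word n (cycle_of_list cs) = cs" "one_line n (cycle_of_list cs) = ws"
    and av: "avoids ws \<sigma>" "avoids cs \<tau>"
    and uniq: "\<And>\<pi>. \<pi> \<in> cyclic_avoiders n \<sigma> \<tau> \<Longrightarrow> one_line n \<pi> = ws"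
  shows "cyclic_avoiders n \<sigma> \<tau> = {cycle_of_list cs}"
proof -
  have perm: "cycle_of_list cs permutes {1..n}"
    using cycle_permutes[of cs] cs by simp
  \<comment> \<open>Both permutations fix every point outside \<open>{1..n}\<close>, so equal
    one-line words suffice.\<close>
  moreover have "\<pi> = cycle_of_list cs" if "\<pi> \<in> cyclic_avoiders n \<sigma> \<tau>" for \<pi>
  proof
    fix x
    have "one_line n \<pi> = one_line n (cycle_of_list cs)"
      using uniq[OF that] words by simp
    then have eq: "\<forall>y\<in>set [1..<n + 1]. \<pi> y = cycle_of_list cs y"
      by (simp only: one_line_def map_eq_conv)
    have "\<pi> permutes {1..n}"
      using that by (simp add: cyclic_avoiders_def)
    with perm eq show "\<pi> x = cycle_of_list cs x"
      by (cases "x \<in> {1..n}") (simp_all add: permutes_not_in del: upt_Suc)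
  qed
  ultimately show ?thesis
    using cyclic_on_iff_cycle_word[OF perm n] words cs av
    by (auto simp: cyclic_avoiders_def)
qed

text \<open>The surviving cycle words are 1, 12, 132 and 1423. For n <= 2 there is only one cyclic
  permutation; for n = 3 and n = 4 the possible cycle words are enumerated.\<close>

lemma cyclic_avoiders_231_321_le_4:
  assumes "1 \<le> n" "n \<le> 4"
  shows "\<exists>\<pi>. cyclic_avoiders n [2, 3, 1] [3, 2, 1] = {\<pi>}"
proof -
  note compute = one_line_def cycle_word_def
    All_less_Suc eval_nat_numeral atLeastAtMostSuc_conv transpose_def
  have mem: "set (cycle_word n \<pi>) = {1..n}" "(\<pi> ^^ n) 1 = 1"
      "avoids (one_line n \<pi>) [2, 3, 1]" "avoids (cycle_word n \<pi>) [3, 2, 1]"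
    if "\<pi> \<in> cyclic_avoiders n [2, 3, 1] [3, 2, 1]" for \<pi>
  proof -
    have cyc: "cyclic_on \<pi> {1..n}"
      using that by (simp add: cyclic_avoiders_def)
    show "set (cycle_word n \<pi>) = {1..n}" "(\<pi> ^^ n) 1 = 1"
      using cyclic_on_funpow_card[OF cyc, of 1] assms by (simp_all add: set_cycle_word)
    show "avoids (one_line n \<pi>) [2, 3, 1]" "avoids (cycle_word n \<pi>) [3, 2, 1]"
      using that by (simp_all add: cyclic_avoiders_def)
  qed
  consider "n = 1" | "n = 2" | "n = 3" | "n = 4"
    using assms by linarith
  then show ?thesis
  proof cases
    case 1
    have "cyclic_avoiders n [2, 3, 1] [3, 2, 1] = {cycle_of_list [1]}"
    proof (rule cyclic_avoiders_eqI[where ws = "[1]"])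
      fix \<pi> assume "\<pi> \<in> cyclic_avoiders n [2, 3, 1] [3, 2, 1]"
      from mem[OF this] show "one_line n \<pi> = [1]"
        by (simp add: 1 one_line_def)
    qed (unfold avoids_231_iff avoids_321_iff, simp_all add: 1 compute)
    then show ?thesis by blast
  next
    case 2
    have "cyclic_avoiders n [2, 3, 1] [3, 2, 1] = {cycle_of_list [1, 2]}"
    proof (rule cyclic_avoiders_eqI[where ws = "[2, 1]"])
      fix \<pi> assume "\<pi> \<in> cyclic_avoiders n [2, 3, 1] [3, 2, 1]"
      note \<pi> = mem[OF this]
      have "{1, \<pi> 1} = {1, 2}" "\<pi> (\<pi> 1) = 1"
        using \<pi>(1,2) by (simp_all add: 2 compute insert_commute)
      then have "\<pi> 1 = 2" "\<pi> 2 = 1"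
        by (auto simp: doubleton_eq_iff)
      then show "one_line n \<pi> = [2, 1]"
        by (simp add: 2 one_line_def numeral_eq_Suc)
    qed (unfold avoids_231_iff avoids_321_iff, auto simp: 2 compute)
    then show ?thesis by blast
  next
    case 3
    have "cyclic_avoiders n [2, 3, 1] [3, 2, 1] = {cycle_of_list [1, 3, 2]}"
    proof (rule cyclic_avoiders_eqI[where ws = "[3, 1, 2]"])
      fix \<pi> assume "\<pi> \<in> cyclic_avoiders n [2, 3, 1] [3, 2, 1]"
      note \<pi> = mem[OF this]
      define x y where xy: "x = \<pi> 1" "y = \<pi> x"
      have xy_eq: "{1, x, y} = {1, 2, 3}" and "\<pi> y = 1"
        using \<pi>(1,2) by (simp_all add: 3 xy compute insert_commute)
      have "distinct [1, x, y]"
        by (rule card_distinct) (simp add: xy_eq del: One_nat_def)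
      moreover have "x \<in> {1, 2, 3}" "y \<in> {1, 2, 3}"
        using xy_eq by blast+
      ultimately have "x = 2 \<and> y = 3 \<or> x = 3 \<and> y = 2"
        by auto
      moreover have "\<not> (\<pi> 3 < \<pi> 1 \<and> \<pi> 1 < \<pi> 2)"
        using \<pi>(3) unfolding avoids_231_iff by (simp add: 3 compute)
      moreover have "one_line n \<pi> = [\<pi> 1, \<pi> 2, \<pi> 3]"
        by (simp add: 3 one_line_def numeral_eq_Suc)
      ultimately show "one_line n \<pi> = [3, 1, 2]"
        using xy \<open>\<pi> y = 1\<close> by auto
    qed (unfold avoids_231_iff avoids_321_iff, auto simp: 3 compute)
    then show ?thesis by blast
  next
    case 4
    have "cyclic_avoiders n [2, 3, 1] [3, 2, 1] = {cycle_of_list [1, 4, 2, 3]}"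
    proof (rule cyclic_avoiders_eqI[where ws = "[4, 3, 1, 2]"])
      fix \<pi> assume "\<pi> \<in> cyclic_avoiders n [2, 3, 1] [3, 2, 1]"
      note \<pi> = mem[OF this]
      define x y z where xyz: "x = \<pi> 1" "y = \<pi> x" "z = \<pi> y"
      have xyz_eq: "{1, x, y, z} = {1, 2, 3, 4}" and "\<pi> z = 1"
        using \<pi>(1,2) by (simp_all add: 4 xyz compute insert_commute)
      have "distinct [1, x, y, z]"
        by (rule card_distinct) (simp add: xyz_eq del: One_nat_def)
      moreover have "x \<in> {1, 2, 3, 4}" "y \<in> {1, 2, 3, 4}" "z \<in> {1, 2, 3, 4}"
        using xyz_eq by blast+
      \<comment> \<open>Of these six, the 321 condition removes (4, 3, 2) and the 231 conditions
        remove all the others except (4, 2, 3).\<close>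
      ultimately have "(x, y, z) \<in> {(2, 3, 4), (2, 4, 3), (3, 2, 4), (3, 4, 2), (4, 2, 3), (4, 3, 2)}"
        by auto
      moreover have "\<not> (\<pi> 3 < \<pi> 1 \<and> \<pi> 1 < \<pi> 2)" "\<not> (\<pi> 4 < \<pi> 1 \<and> \<pi> 1 < \<pi> 2)"
          "\<not> (\<pi> 4 < \<pi> 1 \<and> \<pi> 1 < \<pi> 3)" "\<not> (\<pi> 4 < \<pi> 2 \<and> \<pi> 2 < \<pi> 3)"
        using \<pi>(3) unfolding avoids_231_iff by (simp_all add: 4 compute)
      \<comment> \<open>The leading 1 of the cycle word cannot start a 321, so this is the only
        triple to test.\<close>
      moreover have "\<not> (z < y \<and> y < x)"
        using \<pi>(4) unfolding avoids_321_iff by (simp add: 4 xyz compute)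
      moreover have "one_line n \<pi> = [\<pi> 1, \<pi> 2, \<pi> 3, \<pi> 4]"
        by (simp add: 4 one_line_def numeral_eq_Suc)
      ultimately show "one_line n \<pi> = [4, 3, 1, 2]"
        using xyz \<open>\<pi> z = 1\<close> by auto
    qed (unfold avoids_231_iff avoids_321_iff, auto simp: 4 compute)
    then show ?thesis by blast
  qed
qed

theorem theorem6p14:
  fixes n :: nat
  shows "(1 \<le> n \<and> n \<le> 4 \<longrightarrow> num_cyclic_avoiders n [2, 3, 1] [3, 2, 1] = 1) \<and>
         (n \<ge> 5 \<longrightarrow> num_cyclic_avoiders n [2, 3, 1] [3, 2, 1] = 0)"
  using cyclic_avoiders_231_321_le_4[of n] cyclic_avoiders_231_321_ge_5[of n]
  by (auto simp: num_cyclic_avoiders_def)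

end
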